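(* Let $\Phi$ be a derivation in system $\mathcal{V}$ of $\Gamma \vdash^{(m,e,s)} t:\sigma$, and suppose $\Phi$ is tight. Then there exists $p \in \mathsf{no}_v$ such that $t \to_v^{(m,e)} p$, i.e.\ $t$ reduces to $p$ by $\to_v$ using exactly $m$ multiplicative steps and exactly $e$ exponential steps, and $|p|_v = s$.
   Context: Terms. Fix a countably infinite set of variables. Terms are $t,u,r ::= x \mid \lambda x.t \mid t\,u \mid t[x\backslash u]$, where $t[x\backslash u]$ (explicit substitution) binds $x$ in $t$; terms are taken modulo $\alpha$-conversion and $t\{x:=u\}$ is capture-avoiding meta-level substitution. Values are $v ::= x \mid \lambda x.t$. List contexts are $L ::= \square \mid L[x\backslash t]$; $L\langle t\rangle$ plugs $t$ into the hole. CBV normal forms: $\mathsf{vr}_v ::= x \mid \mathsf{vr}_v[x\backslash \mathsf{ne}_v]$; $\mathsf{ne}_v ::= \mathsf{vr}_v\,\mathsf{no}_v \mid \mathsf{ne}_v\,\mathsf{no}_v \mid \mathsf{ne}_v[x\backslash\mathsf{ne}_v]$; $\mathsf{no}_v ::= \lambda x.t \mid \mathsf{vr}_v \mid \mathsf{ne}_v \mid \mathsf{no}_v[x\backslash\mathsf{ne}_v]$. The $v$-size is $|x|_v = 0$, $|\lambda x.t|_v=0$, $|t\,u|_v = |t|_v+|u|_v+1$, $|t[x\backslash u]|_v = |t|_v+|u|_v$. Reduction. Rule $\mathtt{dB}$: $(L\langle\lambda x.t\rangle)\,u\mapsto L\langle t[x\backslash u]\rangle$; rule $\mathtt{sv}$: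 $t[x\backslash L\langle v\rangle]\mapsto L\langle t\{x:=v\}\rangle$ for a value $v$. CBV contexts are $V ::= \square \mid V\,t \mid t\,V \mid V[x\backslash u] \mid t[x\backslash V]$, and $\to_v$ is the closure of $\mathtt{dB}\cup\mathtt{sv}$ under CBV contexts. $\mathtt{dB}$-steps are multiplicative ($m$-steps), $\mathtt{sv}$-steps exponential ($e$-steps); $t\to_v^{(m,e)}p$ means $t$ reduces to $p$ in finitely many $\to_v$ steps, exactly $m$ of them $m$-steps and $e$ of them $e$-steps. Types. Tight types: $\mathtt{tt} ::= \mathtt{n} \mid \mathtt{vl} \mid \mathtt{vr}$. Types $\sigma,\tau ::= \mathtt{tt}\mid\mathcal{M}\mid\mathcal{M}\to\sigma$, with multitypes $\mathcal{M}=[\sigma_i]_{i\in I}$ finite multisets of types ($[\,]$ empty, $\sqcup$ union, $|\mathcal{M}|$ cardinality). Typing contexts $\Gamma$ map variables to multitypes, $[\,]$ for all but finitely many; $(\Gamma+\Delta)(x)=\Gamma(x)\sqcup\Delta(x)$, extended to finite sums; $\Gamma\setminus\!\!\setminus x$ maps $x$ to $[\,]$ and agrees with $\Gamma$ elsewhere. Judgements $\Gamma\vdash^{(m,e,s)} t:\sigma$ carry integer counters. System $\mathcal{V}$ has the rules: (var$_p$) $x:[\mathtt{vr}]\vdash^{(0,0,0)} x:\mathtt{vr}$; (val$_p$) $\emptyset\vdash^{(0,0,0)} x:\mathtt{vl}$; (abs$_p$) $\emptyset\vdash^{(0,0,0)}\lambda x.t:\mathtt{vl}$; (app$_p$) from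 $\Gamma\vdash^{(m,e,s)} t:\mathtt{tt}_1$ with $\mathtt{tt}_1\in\{\mathtt{vr},\mathtt{n}\}$ and $\Delta\vdash^{(m',e',s')} u:\mathtt{tt}_2$ with $\mathtt{tt}_2\in\{\mathtt{vl},\mathtt{n}\}$, infer $\Gamma+\Delta\vdash^{(m+m',e+e',s+s'+1)} t\,u:\mathtt{n}$; (es$_p$) from $\Gamma\vdash^{(m,e,s)} t:\tau$, $\Delta\vdash^{(m',e',s')} u:\mathtt{n}$ and $\Gamma(x)$ tight, infer $(\Gamma\setminus\!\!\setminus x)+\Delta\vdash^{(m+m',e+e',s+s')} t[x\backslash u]:\tau$; (var$_c$) $x:\mathcal{M}\vdash^{(0,1,0)} x:\mathcal{M}$ for any multitype $\mathcal{M}$; (app$_c$) from $\Gamma\vdash^{(m,e,s)} t:[\mathcal{M}\to\tau]$ and $\Delta\vdash^{(m',e',s')} u:\mathcal{M}$, infer $\Gamma+\Delta\vdash^{(m+m'+1,e+e'-1,s+s')} t\,u:\tau$; (appt$_c$) from $\Gamma\vdash^{(m,e,s)} t:[\mathcal{M}\to\tau]$, $\Delta\vdash^{(m',e',s')} u:\mathtt{n}$ and $\mathcal{M}$ tight, infer $\Gamma+\Delta\vdash^{(m+m'+1,e+e'-1,s+s')} t\,u:\tau$; (abs$_c$) from $\Gamma_i\vdash^{(m_i,e_i,s_i)} t:\tau_i$ for each $i\in I$ ($I$ finite, possibly empty), infer $+_{i\in I}(\Gamma_i\setminus\!\!\setminus x)\vdash^{(\sum_i m_i,\,1+\sum_i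 e_i,\,\sum_i s_i)}\lambda x.t:[\Gamma_i(x)\to\tau_i]_{i\in I}$; (es$_c$) from $\Gamma\vdash^{(m,e,s)} t:\sigma$ and $\Delta\vdash^{(m',e',s')} u:\Gamma(x)$, infer $(\Gamma\setminus\!\!\setminus x)+\Delta\vdash^{(m+m',e+e',s+s')} t[x\backslash u]:\sigma$. A multitype is tight if all its elements are tight types; a context is tight if all its multitypes are tight; a derivation of $\Gamma\vdash^{(m,e,s)} t:\sigma$ is tight if $\Gamma$ is tight and $\sigma$ is a tight type. *)

theory Defs
  imports Main "HOL-Library.Multiset"
begin

(* Terms modulo alpha-conversion, in de Bruijn notation: the set of variables is nat, and a free
   occurrence of the variable i below k binders is the index i + k.
   Lam t is \<lambda>x. t, and ES t u is the explicit substitution t[x\u]; the bound variable x is the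
   index 0 of t in both cases, and u is outside the scope of x. *)
datatype trm =
    Var nat
  | Lam trm
  | App trm trm
  | ES trm trm

inductive is_value :: "trm \<Rightarrow> bool" where
  "is_value (Var x)"
| "is_value (Lam t)"

(* lift d k t adds d to all indices of t that are at least k. *)
primrec lift :: "nat \<Rightarrow> nat \<Rightarrow> trm \<Rightarrow> trm" where
  "lift d k (Var i) = Var (if i < k then i else i + d)"
| "lift d k (Lam t) = Lam (lift d (Suc k) t)"
| "lift d k (App t u) = App (lift d k t) (lift d k u)"
| "lift d k (ES t u) = ES (lift d (Suc k) t) (lift d k u)"

(* subst t k u is t{k:=u}; the variable k disappears, so the indices above k are decremented. *)
primrec subst :: "trm \<Rightarrow> nat \<Rightarrow> trm \<Rightarrow> trm" where
  "subst (Var i) k u = (if i < k then Var i else if i = k then u else Var (i - 1))"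
| "subst (Lam t) k u = Lam (subst t (Suc k) (lift 1 0 u))"
| "subst (App t r) k u = App (subst t k u) (subst r k u)"
| "subst (ES t r) k u = ES (subst t (Suc k) (lift 1 0 u)) (subst r k u)"

datatype lctx =
    LHole
  | LES lctx trm

(* The binders of a context capture, so plugging does not lift. *)
primrec lplug :: "lctx \<Rightarrow> trm \<Rightarrow> trm" where
  "lplug LHole t = t"
| "lplug (LES L u) t = ES (lplug L t) u"

(* The number of binders above the hole. *)
primrec ldepth :: "lctx \<Rightarrow> nat" where
  "ldepth LHole = 0"
| "ldepth (LES L u) = Suc (ldepth L)"

datatype vctx =
    VHole
  | VAppL vctx trm
  | VAppR trm vctx
  | VESL vctx trm
  | VESR trm vctx

primrec vplug :: "vctx \<Rightarrow> trm \<Rightarrow> trm" where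
  "vplug VHole r = r"
| "vplug (VAppL V t) r = App (vplug V r) t"
| "vplug (VAppR t V) r = App t (vplug V r)"
| "vplug (VESL V u) r = ES (vplug V r) u"
| "vplug (VESR t V) r = ES t (vplug V r)"

(* In both rules a subterm moves into the scope of the binders of L. With names, alpha-conversion
   keeps its free variables from being captured; here they are lifted over L. In sv the index 0
   of t is the variable to be substituted, which is why t is lifted from 1 on. *)
inductive dB :: "trm \<Rightarrow> trm \<Rightarrow> bool" where
  "dB (App (lplug L (Lam t)) u) (lplug L (ES t (lift (ldepth L) 0 u)))"

inductive sv :: "trm \<Rightarrow> trm \<Rightarrow> bool" where
  "is_value v \<Longrightarrow> sv (ES t (lplug L v)) (lplug L (subst (lift (ldepth L) 1 t) 0 v))"

inductive step_m :: "trm \<Rightarrow> trm \<Rightarrow> bool" where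
  "dB r r' \<Longrightarrow> step_m (vplug V r) (vplug V r')"

inductive step_e :: "trm \<Rightarrow> trm \<Rightarrow> bool" where
  "sv r r' \<Longrightarrow> step_e (vplug V r) (vplug V r')"

(* reduces m e t p: t reduces to p in m multiplicative and e exponential steps, in any order. *)
inductive reduces :: "nat \<Rightarrow> nat \<Rightarrow> trm \<Rightarrow> trm \<Rightarrow> bool" where
  refl: "reduces 0 0 t t"
| mult: "step_m t u \<Longrightarrow> reduces m e u p \<Longrightarrow> reduces (Suc m) e t p"
| expo: "step_e t u \<Longrightarrow> reduces m e u p \<Longrightarrow> reduces m (Suc e) t p"

inductive vr_v :: "trm \<Rightarrow> bool" and ne_v :: "trm \<Rightarrow> bool" and no_v :: "trm \<Rightarrow> bool" where
  "vr_v (Var x)"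
| "vr_v t \<Longrightarrow> ne_v u \<Longrightarrow> vr_v (ES t u)"
| "vr_v t \<Longrightarrow> no_v u \<Longrightarrow> ne_v (App t u)"
| "ne_v t \<Longrightarrow> no_v u \<Longrightarrow> ne_v (App t u)"
| "ne_v t \<Longrightarrow> ne_v u \<Longrightarrow> ne_v (ES t u)"
| "no_v (Lam t)"
| "vr_v t \<Longrightarrow> no_v t"
| "ne_v t \<Longrightarrow> no_v t"
| "no_v t \<Longrightarrow> ne_v u \<Longrightarrow> no_v (ES t u)"

primrec vsize :: "trm \<Rightarrow> nat" where
  "vsize (Var x) = 0"
| "vsize (Lam t) = 0"
| "vsize (App t u) = vsize t + vsize u + 1"
| "vsize (ES t u) = vsize t + vsize u"

datatype tight_const = N | Vl | Vr

datatype ty =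
    Tight tight_const
  | Multi "ty multiset"
  | Arrow "ty multiset" ty

type_synonym mty = "ty multiset"
type_synonym ctx = "nat \<Rightarrow> mty"

definition tight_ty :: "ty \<Rightarrow> bool" where
  "tight_ty \<sigma> \<longleftrightarrow> (\<exists>c. \<sigma> = Tight c)"

definition tight_mty :: "mty \<Rightarrow> bool" where
  "tight_mty M \<longleftrightarrow> (\<forall>\<sigma>\<in>#M. tight_ty \<sigma>)"

definition tight_ctx :: "ctx \<Rightarrow> bool" where
  "tight_ctx \<Gamma> \<longleftrightarrow> (\<forall>x. tight_mty (\<Gamma> x))"

definition ctx_empty :: ctx where
  "ctx_empty = (\<lambda>x. {#})"

definition ctx_single :: "nat \<Rightarrow> mty \<Rightarrow> ctx" where
  "ctx_single x M = ctx_empty(x := M)"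

definition ctx_add :: "ctx \<Rightarrow> ctx \<Rightarrow> ctx" where
  "ctx_add \<Gamma> \<Delta> = (\<lambda>x. \<Gamma> x + \<Delta> x)"

definition ctx_sum :: "nat set \<Rightarrow> (nat \<Rightarrow> ctx) \<Rightarrow> ctx" where
  "ctx_sum I \<Gamma> = (\<lambda>x. \<Sum>i\<in>I. \<Gamma> i x)"

(* The removal of the variable x bound by an abstraction or an explicit substitution: x is the
   index 0 of the body, so the remaining variables are renumbered. *)
definition ctx_pop :: "ctx \<Rightarrow> ctx" where
  "ctx_pop \<Gamma> = (\<lambda>x. \<Gamma> (Suc x))"

(* typing \<Gamma> m e s t \<sigma>: there is a derivation of \<Gamma> \<turnstile>(m,e,s) t : \<sigma> in system V. *)
inductive typing :: "ctx \<Rightarrow> int \<Rightarrow> int \<Rightarrow> int \<Rightarrow> trm \<Rightarrow> ty \<Rightarrow> bool" where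
  var_p: "typing (ctx_single x {#Tight Vr#}) 0 0 0 (Var x) (Tight Vr)"
| val_p: "typing ctx_empty 0 0 0 (Var x) (Tight Vl)"
| abs_p: "typing ctx_empty 0 0 0 (Lam t) (Tight Vl)"
| app_p: "typing \<Gamma> m e s t (Tight c1) \<Longrightarrow> c1 \<in> {Vr, N} \<Longrightarrow>
    typing \<Delta> m' e' s' u (Tight c2) \<Longrightarrow> c2 \<in> {Vl, N} \<Longrightarrow>
    typing (ctx_add \<Gamma> \<Delta>) (m + m') (e + e') (s + s' + 1) (App t u) (Tight N)"
| es_p: "typing \<Gamma> m e s t \<tau> \<Longrightarrow> typing \<Delta> m' e' s' u (Tight N) \<Longrightarrow> tight_mty (\<Gamma> 0) \<Longrightarrow>
    typing (ctx_add (ctx_pop \<Gamma>) \<Delta>) (m + m') (e + e') (s + s') (ES t u) \<tau>"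
| var_c: "typing (ctx_single x M) 0 1 0 (Var x) (Multi M)"
| app_c: "typing \<Gamma> m e s t (Multi {#Arrow M \<tau>#}) \<Longrightarrow> typing \<Delta> m' e' s' u (Multi M) \<Longrightarrow>
    typing (ctx_add \<Gamma> \<Delta>) (m + m' + 1) (e + e' - 1) (s + s') (App t u) \<tau>"
| appt_c: "typing \<Gamma> m e s t (Multi {#Arrow M \<tau>#}) \<Longrightarrow> typing \<Delta> m' e' s' u (Tight N) \<Longrightarrow>
    tight_mty M \<Longrightarrow>
    typing (ctx_add \<Gamma> \<Delta>) (m + m' + 1) (e + e' - 1) (s + s') (App t u) \<tau>"
| abs_c: "finite I \<Longrightarrow> (\<And>i. i \<in> I \<Longrightarrow> typing (\<Gamma> i) (m i) (e i) (s i) t (\<tau> i)) \<Longrightarrow>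
    typing (ctx_sum I (\<lambda>i. ctx_pop (\<Gamma> i))) (\<Sum>i\<in>I. m i) (1 + (\<Sum>i\<in>I. e i)) (\<Sum>i\<in>I. s i)
      (Lam t) (Multi (image_mset (\<lambda>i. Arrow (\<Gamma> i 0) (\<tau> i)) (mset_set I)))"
| es_c: "typing \<Gamma> m e s t \<sigma> \<Longrightarrow> typing \<Delta> m' e' s' u (Multi (\<Gamma> 0)) \<Longrightarrow>
    typing (ctx_add (ctx_pop \<Gamma>) \<Delta>) (m + m') (e + e') (s + s') (ES t u) \<sigma>"

(* Finiteness of the support is part of the notion of a typing context; it need not be imposed,
   as the rules guarantee it. *)
lemma finite_ctx_pop: "finite {x. \<Gamma> x \<noteq> {#}} \<Longrightarrow> finite {x. ctx_pop \<Gamma> x \<noteq> {#}}"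
  using finite_vimageI[of "{x. \<Gamma> x \<noteq> {#}}" Suc] by (simp add: ctx_pop_def vimage_def)

lemma finite_ctx_add:
  "finite {x. \<Gamma> x \<noteq> {#}} \<Longrightarrow> finite {x. \<Delta> x \<noteq> {#}} \<Longrightarrow> finite {x. ctx_add \<Gamma> \<Delta> x \<noteq> {#}}"
  by (rule finite_subset[of _ "{x. \<Gamma> x \<noteq> {#}} \<union> {x. \<Delta> x \<noteq> {#}}"]) (auto simp: ctx_add_def)

lemma finite_ctx_sum:
  assumes "finite I" "\<And>i. i \<in> I \<Longrightarrow> finite {x. \<Gamma> i x \<noteq> {#}}"
  shows "finite {x. ctx_sum I \<Gamma> x \<noteq> {#}}"
proof (rule finite_subset)
  show "{x. ctx_sum I \<Gamma> x \<noteq> {#}} \<subseteq> (\<Union>i\<in>I. {x. \<Gamma> i x \<noteq> {#}})"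
    unfolding ctx_sum_def by (blast intro: sum.neutral)
  show "finite (\<Union>i\<in>I. {x. \<Gamma> i x \<noteq> {#}})"
    using assms by blast
qed

lemma typing_finite_support: "typing \<Gamma> m e s t \<sigma> \<Longrightarrow> finite {x. \<Gamma> x \<noteq> {#}}"
proof (induction rule: typing.induct)
  case (var_p x)
  show ?case by (rule finite_subset[of _ "{x}"]) (auto simp: ctx_single_def ctx_empty_def)
next
  case (var_c x M)
  show ?case by (rule finite_subset[of _ "{x}"]) (auto simp: ctx_single_def ctx_empty_def)
next
  case (abs_c I \<Gamma> m e s t \<tau>)
  show ?case by (rule finite_ctx_sum[OF abs_c.hyps(1) finite_ctx_pop[OF abs_c.IH]])
next
  case val_p
  show ?case by (simp add: ctx_empty_def)
next
  case abs_p
  show ?case by (simp add: ctx_empty_def)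
qed (simp_all only: finite_ctx_add finite_ctx_pop)

end

theory Submission imports Defs
begin

text \<open>
  Every step fires a subterm that lies under no abstraction, and such a subterm is typed exactly
  once by any derivation. Hence subject reduction holds for arbitrary derivations, tight or not,
  and a step lowers exactly one counter, \<open>m\<close> or \<open>e\<close>, by exactly one. The counter \<open>e\<close> alone may be
  negative, but in \<open>m + e\<close> the \<open>+ 1\<close> and \<open>- 1\<close> of the application rules cancel, so it is never
  negative and bounds the length of reductions. In an irreducible term
  with a tight context, a subterm of multitype is a value under a list context; it is neither
  applied nor substituted, so only the rules with index \<open>p\<close> remain, and these count \<open>0\<close> steps and
  the size of the normal form.
\<close>

section \<open>Operations on contexts and inversion of the typing rules\<close>

lemmas ctx_defs = ctx_empty_def ctx_single_def ctx_add_def ctx_sum_def ctx_pop_def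

definition ctx_lift :: "nat \<Rightarrow> nat \<Rightarrow> ctx \<Rightarrow> ctx" where
  "ctx_lift d k \<Gamma> = (\<lambda>x. if x < k then \<Gamma> x else if x < k + d then {#} else \<Gamma> (x - d))"

text \<open>The context side of \<open>subst\<close> at index \<open>k\<close>, which decrements the
  indices above \<open>k\<close>. \<open>ctx_pop\<close> is the case of index 0; a general
  \<open>k\<close> is required because substitution descends under binders.\<close>

definition ctx_del :: "nat \<Rightarrow> ctx \<Rightarrow> ctx" where
  "ctx_del k \<Gamma> = (\<lambda>x. if x < k then \<Gamma> x else \<Gamma> (Suc x))"

inductive_cases typing_VarE: "typing \<Gamma> m e s (Var x) \<sigma>"
inductive_cases typing_LamE [consumes 1]: "typing \<Gamma> m e s (Lam t) \<sigma>"
inductive_cases typing_AppE [consumes 1]: "typing \<Gamma> m e s (App t u) \<sigma>"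
inductive_cases typing_ESE [consumes 1]: "typing \<Gamma> m e s (ES t u) \<sigma>"

text \<open>Lets a typing rule be applied first and leaves the arithmetic of the counters and the
  equality of contexts as separate goals.\<close>

lemma typing_cong:
  "\<lbrakk>typing \<Gamma> m e s t \<sigma>; \<Gamma> = \<Gamma>'; m = m'; e = e'; s = s'; \<sigma> = \<sigma>'\<rbrakk> \<Longrightarrow> typing \<Gamma>' m' e' s' t \<sigma>'"
  by simp

lemma typing_counters_nonneg: "typing \<Gamma> m e s t \<sigma> \<Longrightarrow> 0 \<le> m + e"
proof (induction rule: typing.induct)
  case (abs_c I \<Gamma> m e s t \<tau>)
  then have "0 \<le> (\<Sum>i\<in>I. m i + e i)" by (intro sum_nonneg)
  then show ?case by (simp add: sum.distrib)
qed simp_all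

section \<open>Lifting\<close>

lemma lift_0 [simp]: "lift 0 k t = t"
  by (induction t arbitrary: k) auto

lemma lift_lift: "lift c k (lift d k t) = lift (c + d) k t"
  by (induction t arbitrary: k) auto

lemma is_value_lift: "is_value v \<Longrightarrow> is_value (lift d k v)"
  by (auto simp: is_value.simps)

lemma ctx_lift_empty: "ctx_lift d k ctx_empty = ctx_empty"
  by (simp add: ctx_lift_def ctx_defs fun_eq_iff)

lemma ctx_lift_single:
  "ctx_lift d k (ctx_single x M) = ctx_single (if x < k then x else x + d) M"
  by (auto simp: ctx_lift_def ctx_defs fun_eq_iff)

lemma ctx_lift_add: "ctx_lift d k (ctx_add \<Gamma> \<Delta>) = ctx_add (ctx_lift d k \<Gamma>) (ctx_lift d k \<Delta>)"
  by (simp add: ctx_lift_def ctx_defs fun_eq_iff)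

lemma ctx_lift_sum: "ctx_lift d k (ctx_sum I \<Gamma>) = ctx_sum I (\<lambda>i. ctx_lift d k (\<Gamma> i))"
  by (simp add: ctx_lift_def ctx_defs fun_eq_iff)

lemma ctx_pop_lift: "ctx_pop (ctx_lift d (Suc k) \<Gamma>) = ctx_lift d k (ctx_pop \<Gamma>)"
  by (auto simp: ctx_lift_def ctx_defs fun_eq_iff Suc_diff_le)

text \<open>Rules for binders read the multitype of index 0: as an arrow domain, as the type of the
  argument, or in a tightness condition. Lifting below the binder starts at \<open>Suc k\<close> and
  so respects all three.\<close>

lemma ctx_lift_Suc_0 [simp]: "ctx_lift d (Suc k) \<Gamma> 0 = \<Gamma> 0"
  by (simp add: ctx_lift_def)

lemma typing_lift:
  "typing \<Gamma> m e s t \<sigma> \<Longrightarrow> typing (ctx_lift d k \<Gamma>) m e s (lift d k t) \<sigma>"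
proof (induction arbitrary: k rule: typing.induct)
  case (abs_c I \<Gamma> m e s t \<tau>)
  have "typing (ctx_lift d (Suc k) (\<Gamma> i)) (m i) (e i) (s i) (lift d (Suc k) t) (\<tau> i)"
    if "i \<in> I" for i using abs_c.IH[OF that] .
  from typing.abs_c[OF abs_c.hyps(1) this]
  show ?case by (simp add: ctx_lift_sum ctx_pop_lift)
next
  case (es_p \<Gamma> m e s t \<tau> \<Delta> m' e' s' u)
  then show ?case
    using typing.es_p[OF es_p.IH(1)[of "Suc k"] es_p.IH(2)[of k]]
    by (simp add: ctx_lift_add ctx_pop_lift)
next
  case (es_c \<Gamma> m e s t \<sigma> \<Delta> m' e' s' u)
  then show ?case
    using typing.es_c[OF es_c.IH(1)[of "Suc k"], of "ctx_lift d k \<Delta>" m' e' s' "lift d k u"]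
    by (simp add: ctx_lift_add ctx_pop_lift)
qed (auto simp: ctx_lift_empty ctx_lift_single ctx_lift_add intro: typing.intros)

section \<open>Splitting the multitype of a value\<close>

text \<open>Only \<open>var_c\<close> and \<open>abs_c\<close> give a value a multitype, and both
  charge 1 to \<open>e\<close>, even when nothing uses the value. With the empty multitype,
  \<open>abs_c\<close> has no premises and this 1 is all that remains.\<close>

lemma typing_value_empty:
  assumes "is_value v" "typing \<Delta> m e s v (Multi {#})"
  shows "\<Delta> = ctx_empty \<and> m = 0 \<and> e = 1 \<and> s = 0"
  using assms by (auto simp: is_value.simps ctx_defs fun_eq_iff mset_set_empty_iff
      elim!: typing_VarE typing_LamE)

lemma typing_Lam_MultiE:
  assumes "typing \<Gamma> m e s (Lam t) (Multi M)"
  obtains I \<Gamma>s ms es ss \<tau>s where "finite I"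
    "\<And>i. i \<in> I \<Longrightarrow> typing (\<Gamma>s i) (ms i) (es i) (ss i) t (\<tau>s i)"
    "\<Gamma> = ctx_sum I (\<lambda>i. ctx_pop (\<Gamma>s i))" "m = sum ms I" "e = 1 + sum es I" "s = sum ss I"
    "M = image_mset (\<lambda>i. Arrow (\<Gamma>s i 0) (\<tau>s i)) (mset_set I)"
  using assms
proof (cases rule: typing_LamE)
  case (2 I \<Gamma>s ms es ss \<tau>s)
  then show ?thesis using that[of I \<Gamma>s ms es ss \<tau>s] by blast
qed simp

text \<open>No element of \<open>mset_set I\<close> has multiplicity above one, so both summands are
  duplicate-free and disjoint; their supports are the witnesses. This splits the index set of
  \<open>abs_c\<close>.\<close>

lemma mset_set_eq_plusD:
  assumes "finite I" "mset_set I = A + B"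
  obtains J K where "I = J \<union> K" "J \<inter> K = {}" "A = mset_set J" "B = mset_set K"
proof
  have A: "A \<subseteq># mset_set I" and B: "B \<subseteq># mset_set I" using assms by simp_all
  have cnt: "count A i + count B i = (if i \<in> I then 1 else 0)" for i
    using arg_cong[OF assms(2), of "\<lambda>M. count M i"] assms(1) by (simp add: count_mset_set')
  show "I = set_mset A \<union> set_mset B"
    using arg_cong[OF assms(2), of set_mset] assms(1) by simp
  show "set_mset A \<inter> set_mset B = {}"
  proof (rule equals0I)
    fix i assume "i \<in> set_mset A \<inter> set_mset B"
    then have "i \<in># A" "i \<in># B" by auto
    then have "count A i > 0" "count B i > 0" by (simp_all only: count_greater_zero_iff)
    moreover have "count A i + count B i \<le> 1" by (simp add: cnt)
    ultimately show False by linarith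
  qed
  show "A = mset_set (set_mset A)"
  proof (rule multiset_eqI)
    fix i show "count A i = count (mset_set (set_mset A)) i"
      using cnt[of i] by (auto simp: count_mset_set' not_in_iff split: if_splits simp flip: count_greater_zero_iff)
  qed
  show "B = mset_set (set_mset B)"
  proof (rule multiset_eqI)
    fix i show "count B i = count (mset_set (set_mset B)) i"
      using cnt[of i] by (auto simp: count_mset_set' not_in_iff split: if_splits simp flip: count_greater_zero_iff)
  qed
qed

text \<open>A variable is retyped by two instances of \<open>var_c\<close>, and the premises of
  \<open>abs_c\<close> are distributed over two instances. Each half pays the 1 that the whole pays
  once, hence the \<open>- 1\<close> in the equation for \<open>e\<close>.\<close>

lemma typing_value_split:
  assumes "is_value v" "typing \<Delta> m e s v (Multi (A + B))"
  obtains \<Delta>1 m1 e1 s1 \<Delta>2 m2 e2 s2 where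
    "typing \<Delta>1 m1 e1 s1 v (Multi A)" "typing \<Delta>2 m2 e2 s2 v (Multi B)"
    "\<Delta> = ctx_add \<Delta>1 \<Delta>2" "m = m1 + m2" "e = e1 + e2 - 1" "s = s1 + s2"
  using assms(1)
proof cases
  case (1 x)
  have "ctx_single x (A + B) = ctx_add (ctx_single x A) (ctx_single x B)"
    by (simp add: ctx_defs fun_eq_iff)
  moreover have "\<Delta> = ctx_single x (A + B) \<and> m = 0 \<and> e = 1 \<and> s = 0"
    using assms(2) unfolding 1 by (auto elim: typing_VarE)
  ultimately show ?thesis
    using that[of "ctx_single x A" 0 1 0 "ctx_single x B" 0 1 0] 1 by (auto intro: var_c)
next
  case (2 t)
  from assms(2)[unfolded 2] obtain I \<Gamma> ms es ss \<tau> where I: "finite I"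
    and ty: "\<And>i. i \<in> I \<Longrightarrow> typing (\<Gamma> i) (ms i) (es i) (ss i) t (\<tau> i)"
    and eqs: "\<Delta> = ctx_sum I (\<lambda>i. ctx_pop (\<Gamma> i))" "m = sum ms I" "e = 1 + sum es I" "s = sum ss I"
    and AB: "A + B = image_mset (\<lambda>i. Arrow (\<Gamma> i 0) (\<tau> i)) (mset_set I)"
    by (rule typing_Lam_MultiE) blast
  \<comment> \<open>Different indices may yield equal types, so the split of the types is pulled
    back to a split of the indices.\<close>
  from image_mset_eq_plusD[OF AB[symmetric]] obtain A' B' where "mset_set I = A' + B'"
    and im: "A = image_mset (\<lambda>i. Arrow (\<Gamma> i 0) (\<tau> i)) A'"
      "B = image_mset (\<lambda>i. Arrow (\<Gamma> i 0) (\<tau> i)) B'" by blast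
  with I obtain J K where JK: "I = J \<union> K" "J \<inter> K = {}" "A' = mset_set J" "B' = mset_set K"
    using mset_set_eq_plusD by metis
  have fin: "finite J" "finite K" using I JK by auto
  have tyJ: "typing (ctx_sum J (\<lambda>i. ctx_pop (\<Gamma> i))) (sum ms J) (1 + sum es J) (sum ss J) v (Multi A)"
    unfolding 2 im JK(3) by (rule typing.abs_c[OF fin(1)]) (use ty JK(1) in blast)
  have tyK: "typing (ctx_sum K (\<lambda>i. ctx_pop (\<Gamma> i))) (sum ms K) (1 + sum es K) (sum ss K) v (Multi B)"
    unfolding 2 im JK(4) by (rule typing.abs_c[OF fin(2)]) (use ty JK(1) in blast)
  show ?thesis
    by (rule that[OF tyJ tyK]) (use fin JK eqs in \<open>auto simp: sum.union_disjoint ctx_defs\<close>)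
qed

text \<open>Supplies each premise of \<open>abs_c\<close> with its own derivation for the
  substituted value. The quantity \<open>e - 1\<close> is additive under splitting, which gives the
  equation for \<open>e\<close>.\<close>

lemma typing_value_split_sum:
  fixes A :: "'i \<Rightarrow> mty"
  assumes "finite I" "is_value v" "typing \<Delta> m e s v (Multi (\<Sum>i\<in>I. A i))"
  shows "\<exists>\<Delta>s ms es ss. (\<forall>i\<in>I. typing (\<Delta>s i) (ms i) (es i) (ss i) v (Multi (A i))) \<and>
    \<Delta> = (\<lambda>x. \<Sum>i\<in>I. \<Delta>s i x) \<and> m = sum ms I \<and> e = 1 + (\<Sum>i\<in>I. es i - 1) \<and> s = sum ss I"
  using assms(1,3)
proof (induction I arbitrary: \<Delta> m e s rule: finite_induct)
  case empty
  then show ?case using typing_value_empty[OF assms(2)] by (force simp: ctx_empty_def)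
next
  case (insert j I)
  then have "typing \<Delta> m e s v (Multi (A j + (\<Sum>i\<in>I. A i)))" by simp
  from typing_value_split[OF assms(2) this] obtain \<Delta>1 m1 e1 s1 \<Delta>2 m2 e2 s2 where
    1: "typing \<Delta>1 m1 e1 s1 v (Multi (A j))" and 2: "typing \<Delta>2 m2 e2 s2 v (Multi (\<Sum>i\<in>I. A i))"
    and eqs: "\<Delta> = ctx_add \<Delta>1 \<Delta>2" "m = m1 + m2" "e = e1 + e2 - 1" "s = s1 + s2" by metis
  from insert.IH[OF 2] obtain \<Delta>s ms es ss where
    "\<forall>i\<in>I. typing (\<Delta>s i) (ms i) (es i) (ss i) v (Multi (A i))"
    "\<Delta>2 = (\<lambda>x. \<Sum>i\<in>I. \<Delta>s i x)" "m2 = sum ms I" "e2 = 1 + (\<Sum>i\<in>I. es i - 1)" "s2 = sum ss I"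
    by blast
  moreover have "(\<Sum>i\<in>I. (f(j := a)) i) = sum f I" for f :: "'i \<Rightarrow> int" and a
    using insert.hyps by (intro sum.cong) auto
  moreover have "(\<Sum>i\<in>I. (f(j := a)) i - 1) = (\<Sum>i\<in>I. f i - 1)" for f :: "'i \<Rightarrow> int" and a
    using insert.hyps by (intro sum.cong) auto
  moreover have "(\<Sum>i\<in>I. (f(j := a)) i x) = (\<Sum>i\<in>I. f i x)" for f :: "'i \<Rightarrow> ctx" and a x
    using insert.hyps by (intro sum.cong) auto
  ultimately show ?case using insert.hyps 1 eqs
    by (intro exI[of _ "\<Delta>s(j := \<Delta>1)"] exI[of _ "ms(j := m1)"] exI[of _ "es(j := e1)"]
        exI[of _ "ss(j := s1)"])
      (simp add: ctx_add_def)
qed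

section \<open>Substitution\<close>

text \<open>Below a binder the substituted value is lifted and the index is \<open>Suc k\<close>;
  this turns the context obtained there into the one required outside.\<close>

lemma ctx_pop_del_add_lift:
  "ctx_pop (ctx_add (ctx_del (Suc k) \<Gamma>) (ctx_lift 1 0 \<Delta>)) = ctx_add (ctx_del k (ctx_pop \<Gamma>)) \<Delta>"
  by (simp add: ctx_defs ctx_del_def ctx_lift_def fun_eq_iff)

text \<open>A lifted value does not mention the bound variable, so substitution leaves the multitype
  of that variable alone.\<close>

lemma ctx_del_add_lift_0: "ctx_add (ctx_del (Suc k) \<Gamma>) (ctx_lift 1 0 \<Delta>) 0 = \<Gamma> 0"
  by (simp add: ctx_defs ctx_del_def ctx_lift_def)

lemma ctx_del_add_add:
  "ctx_add (ctx_add (ctx_del k \<Gamma>) \<Delta>1) (ctx_add (ctx_del k \<Gamma>') \<Delta>2) =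
    ctx_add (ctx_del k (ctx_add \<Gamma> \<Gamma>')) (ctx_add \<Delta>1 \<Delta>2)"
  by (simp add: ctx_defs ctx_del_def fun_eq_iff)

lemma typing_value_Vl: "is_value v \<Longrightarrow> typing ctx_empty 0 0 0 v (Tight Vl)"
  by (auto simp: is_value.simps intro: val_p abs_p)

text \<open>Abstractions only get multitypes of arrows, so the value is a variable;
  \<open>var_c\<close> is exchanged for \<open>var_p\<close>, which saves 1.\<close>

lemma typing_value_Vr:
  assumes "is_value v" "typing \<Delta> m e s v (Multi {#Tight Vr#})"
  shows "typing \<Delta> m (e - 1) s v (Tight Vr)"
  using assms(1)
proof cases
  case (1 x)
  with assms(2) show ?thesis by (auto elim!: typing_VarE intro: var_p)
next
  case (2 t)
  from assms(2)[unfolded 2] obtain I and \<Gamma> :: "nat \<Rightarrow> ctx" and \<tau> where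
    "{#Tight Vr#} = image_mset (\<lambda>i. Arrow (\<Gamma> i 0) (\<tau> i)) (mset_set I)"
    by (rule typing_Lam_MultiE) blast
  from arg_cong[OF this, of set_mset] show ?thesis by auto
qed

text \<open>The derivation of \<open>v\<close> is split along the rules until it reaches the axioms.
  At index \<open>k\<close> it replaces \<open>var_c\<close>, whose 1 is dropped, or is converted to
  the type \<open>Vr\<close>, which lowers its own counter by 1; elsewhere it is empty and
  contributes exactly 1. In each case the \<open>- 1\<close> balances.\<close>

lemma typing_subst:
  assumes "typing \<Gamma> m e s t \<sigma>" "is_value v" "typing \<Delta> m' e' s' v (Multi (\<Gamma> k))"
  shows "typing (ctx_add (ctx_del k \<Gamma>) \<Delta>) (m + m') (e + e' - 1) (s + s') (subst t k v) \<sigma>"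
  using assms
proof (induction arbitrary: k v \<Delta> m' e' s' rule: typing.induct)
  case (var_p x)
  show ?case
  proof (cases "x = k")
    case True
    have "ctx_add (ctx_del k (ctx_single k {#Tight Vr#})) \<Delta> = \<Delta>"
      by (simp add: ctx_defs ctx_del_def fun_eq_iff)
    moreover have "typing \<Delta> m' e' s' v (Multi {#Tight Vr#})"
      using var_p(2) True by (simp add: ctx_single_def)
    ultimately show ?thesis using typing_value_Vr[OF var_p(1)] True by simp
  next
    case False
    with var_p have "typing \<Delta> m' e' s' v (Multi {#})" by (simp add: ctx_defs)
    note eq = typing_value_empty[OF var_p(1) this]
    have "ctx_del k (ctx_single x M) = ctx_single (if x < k then x else x - 1) M" for M
      using False by (auto simp: ctx_defs ctx_del_def fun_eq_iff)
    with eq False show ?thesis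
      using typing.var_p[of "if x < k then x else x - 1"] by (auto simp: ctx_add_def ctx_empty_def)
  qed
next
  case (var_c x M)
  show ?case
  proof (cases "x = k")
    case True
    have "ctx_add (ctx_del k (ctx_single k M)) \<Delta> = \<Delta>"
      by (simp add: ctx_defs ctx_del_def fun_eq_iff)
    moreover have "typing \<Delta> m' e' s' v (Multi M)"
      using var_c(2) True by (simp add: ctx_single_def)
    ultimately show ?thesis using True by simp
  next
    case False
    with var_c have "typing \<Delta> m' e' s' v (Multi {#})" by (simp add: ctx_defs)
    note eq = typing_value_empty[OF var_c(1) this]
    have "ctx_del k (ctx_single x M) = ctx_single (if x < k then x else x - 1) M"
      using False by (auto simp: ctx_defs ctx_del_def fun_eq_iff)
    with eq False show ?thesis
      using typing.var_c[of "if x < k then x else x - 1" M] by (auto simp: ctx_add_def ctx_empty_def)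
  qed
next
  case (val_p x)
  have "\<Delta> = ctx_empty \<and> m' = 0 \<and> e' = 1 \<and> s' = 0"
    using typing_value_empty val_p by (simp add: ctx_empty_def)
  \<comment> \<open>If \<open>x\<close> is \<open>k\<close> the result is \<open>v\<close> itself,
    and every value has type \<open>Vl\<close>.\<close>
  moreover have "is_value (subst (Var x) k v)" using val_p by (auto simp: is_value.simps)
  ultimately show ?case using typing_value_Vl by (simp add: ctx_defs ctx_del_def)
next
  case (abs_p t)
  have "\<Delta> = ctx_empty \<and> m' = 0 \<and> e' = 1 \<and> s' = 0"
    using typing_value_empty abs_p by (simp add: ctx_empty_def)
  then show ?case using typing.abs_p by (simp add: ctx_defs ctx_del_def)
next
  case (app_p \<Gamma> m e s t c1 \<Delta>' mu eu su u c2)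
  from app_p.prems(2) have "typing \<Delta> m' e' s' v (Multi (\<Gamma> k + \<Delta>' k))" by (simp add: ctx_add_def)
  from typing_value_split[OF app_p.prems(1) this] obtain \<Delta>1 m1 e1 s1 \<Delta>2 m2 e2 s2 where
    1: "typing \<Delta>1 m1 e1 s1 v (Multi (\<Gamma> k))" and 2: "typing \<Delta>2 m2 e2 s2 v (Multi (\<Delta>' k))"
    and eqs: "\<Delta> = ctx_add \<Delta>1 \<Delta>2" "m' = m1 + m2" "e' = e1 + e2 - 1" "s' = s1 + s2" by metis
  show ?case unfolding subst.simps
    by (rule typing_cong[OF typing.app_p[OF app_p.IH(1)[OF app_p.prems(1) 1] app_p.hyps(2)
            app_p.IH(2)[OF app_p.prems(1) 2] app_p.hyps(4)]])
      (simp_all add: eqs ctx_del_add_add)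
next
  case (app_c \<Gamma> m e s t M \<tau> \<Delta>' mu eu su u)
  from app_c.prems(2) have "typing \<Delta> m' e' s' v (Multi (\<Gamma> k + \<Delta>' k))" by (simp add: ctx_add_def)
  from typing_value_split[OF app_c.prems(1) this] obtain \<Delta>1 m1 e1 s1 \<Delta>2 m2 e2 s2 where
    1: "typing \<Delta>1 m1 e1 s1 v (Multi (\<Gamma> k))" and 2: "typing \<Delta>2 m2 e2 s2 v (Multi (\<Delta>' k))"
    and eqs: "\<Delta> = ctx_add \<Delta>1 \<Delta>2" "m' = m1 + m2" "e' = e1 + e2 - 1" "s' = s1 + s2" by metis
  show ?case unfolding subst.simps
    by (rule typing_cong[OF typing.app_c[OF app_c.IH(1)[OF app_c.prems(1) 1]
            app_c.IH(2)[OF app_c.prems(1) 2]]])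
      (simp_all add: eqs ctx_del_add_add)
next
  case (appt_c \<Gamma> m e s t M \<tau> \<Delta>' mu eu su u)
  from appt_c.prems(2) have "typing \<Delta> m' e' s' v (Multi (\<Gamma> k + \<Delta>' k))" by (simp add: ctx_add_def)
  from typing_value_split[OF appt_c.prems(1) this] obtain \<Delta>1 m1 e1 s1 \<Delta>2 m2 e2 s2 where
    1: "typing \<Delta>1 m1 e1 s1 v (Multi (\<Gamma> k))" and 2: "typing \<Delta>2 m2 e2 s2 v (Multi (\<Delta>' k))"
    and eqs: "\<Delta> = ctx_add \<Delta>1 \<Delta>2" "m' = m1 + m2" "e' = e1 + e2 - 1" "s' = s1 + s2" by metis
  show ?case unfolding subst.simps
    by (rule typing_cong[OF typing.appt_c[OF appt_c.IH(1)[OF appt_c.prems(1) 1]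
            appt_c.IH(2)[OF appt_c.prems(1) 2] appt_c.hyps(3)]])
      (simp_all add: eqs ctx_del_add_add)
next
  case (es_p \<Gamma> m e s t \<tau> \<Delta>' mu eu su u)
  from es_p.prems(2) have "typing \<Delta> m' e' s' v (Multi (\<Gamma> (Suc k) + \<Delta>' k))"
    by (simp add: ctx_add_def ctx_pop_def)
  from typing_value_split[OF es_p.prems(1) this] obtain \<Delta>1 m1 e1 s1 \<Delta>2 m2 e2 s2 where
    1: "typing \<Delta>1 m1 e1 s1 v (Multi (\<Gamma> (Suc k)))" and 2: "typing \<Delta>2 m2 e2 s2 v (Multi (\<Delta>' k))"
    and eqs: "\<Delta> = ctx_add \<Delta>1 \<Delta>2" "m' = m1 + m2" "e' = e1 + e2 - 1" "s' = s1 + s2" by metis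
  note body = es_p.IH(1)[OF is_value_lift[OF es_p.prems(1)] typing_lift[OF 1]]
  show ?case unfolding subst.simps
    by (rule typing_cong[OF typing.es_p[OF body es_p.IH(2)[OF es_p.prems(1) 2]]])
      (simp_all add: eqs ctx_del_add_lift_0[simplified] ctx_pop_del_add_lift[simplified]
        ctx_del_add_add es_p.hyps)
next
  case (es_c \<Gamma> m e s t \<tau> \<Delta>' mu eu su u)
  from es_c.prems(2) have "typing \<Delta> m' e' s' v (Multi (\<Gamma> (Suc k) + \<Delta>' k))"
    by (simp add: ctx_add_def ctx_pop_def)
  from typing_value_split[OF es_c.prems(1) this] obtain \<Delta>1 m1 e1 s1 \<Delta>2 m2 e2 s2 where
    1: "typing \<Delta>1 m1 e1 s1 v (Multi (\<Gamma> (Suc k)))" and 2: "typing \<Delta>2 m2 e2 s2 v (Multi (\<Delta>' k))"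
    and eqs: "\<Delta> = ctx_add \<Delta>1 \<Delta>2" "m' = m1 + m2" "e' = e1 + e2 - 1" "s' = s1 + s2" by metis
  note body = es_c.IH(1)[OF is_value_lift[OF es_c.prems(1)] typing_lift[OF 1, of 1 0]]
  \<comment> \<open>Rule \<open>es_c\<close> wants the multitype of the argument in the form of the
    new body context at 0, so the type of \<open>u\<close> is folded into that form.\<close>
  show ?case unfolding subst.simps
    by (rule typing_cong[OF typing.es_c[OF body,
            OF es_c.IH(2)[OF es_c.prems(1) 2, folded ctx_del_add_lift_0[of k \<Gamma> \<Delta>1]]]])
      (simp_all add: eqs ctx_pop_del_add_lift[simplified] ctx_del_add_add)
next
  case (abs_c I \<Gamma> m e s t \<tau>)
  from abs_c.prems(2) have "typing \<Delta> m' e' s' v (Multi (\<Sum>i\<in>I. \<Gamma> i (Suc k)))"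
    by (simp add: ctx_sum_def ctx_pop_def)
  from typing_value_split_sum[OF abs_c.hyps(1) abs_c.prems(1) this] obtain \<Delta>s ms es ss where
    ty: "\<And>i. i \<in> I \<Longrightarrow> typing (\<Delta>s i) (ms i) (es i) (ss i) v (Multi (\<Gamma> i (Suc k)))" and
    eqs: "\<Delta> = (\<lambda>x. \<Sum>i\<in>I. \<Delta>s i x)" "m' = sum ms I" "e' = 1 + (\<Sum>i\<in>I. es i - 1)" "s' = sum ss I"
    by blast
  note body = abs_c.IH[OF _ is_value_lift[OF abs_c.prems(1)] typing_lift[OF ty]]
  show ?case unfolding subst.simps
    by (rule typing_cong[OF typing.abs_c[OF abs_c.hyps(1) body]])
      (simp_all add: eqs ctx_pop_del_add_lift[simplified] ctx_del_add_lift_0[simplified] sum.distrib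
        ctx_defs ctx_del_def ctx_lift_def sum_subtractf fun_eq_iff)
qed

section \<open>Subject reduction\<close>

lemma typing_lplugD:
  "typing \<Gamma> m e s (lplug L t) \<sigma> \<Longrightarrow> \<exists>\<Gamma>' m' e' s'. typing \<Gamma>' m' e' s' t \<sigma>"
  by (induction L arbitrary: \<Gamma> m e s) (auto elim!: typing_ESE)

lemma typing_value_Tight: "is_value v \<Longrightarrow> typing \<Gamma> m e s v (Tight c) \<Longrightarrow> c \<noteq> N"
  by (auto simp: is_value.simps elim!: typing_VarE typing_LamE)

text \<open>Leaves \<open>es_c\<close> as the only possible last rule for an \<open>sv\<close>
  redex.\<close>

lemma typing_lplug_value_not_N: "is_value v \<Longrightarrow> \<not> typing \<Gamma> m e s (lplug L v) (Tight N)"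
  using typing_lplugD typing_value_Tight by blast

text \<open>Excludes \<open>app_p\<close> as the last rule for a \<open>dB\<close> redex, since its
  function part must have type \<open>Vr\<close> or \<open>N\<close>.\<close>

lemma typing_Lam_Tight: "typing \<Gamma> m e s (Lam t) (Tight c) \<Longrightarrow> c = Vl"
  by (auto elim: typing_LamE)

text \<open>A singleton multitype comes from exactly one premise. The 1 of \<open>abs_c\<close>
  removed here cancels the \<open>- 1\<close> of the application rules, so a \<open>dB\<close> step
  changes \<open>m\<close> only.\<close>

lemma typing_Lam_ArrowE:
  assumes "typing \<Gamma> m e s (Lam t) (Multi {#Arrow M \<tau>#})"
  obtains \<Gamma>' where "\<Gamma> = ctx_pop \<Gamma>'" "M = \<Gamma>' 0" "typing \<Gamma>' m (e - 1) s t \<tau>"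
proof -
  from assms obtain I \<Gamma>s ms es ss \<tau>s where I: "finite I"
    and ty: "\<And>i. i \<in> I \<Longrightarrow> typing (\<Gamma>s i) (ms i) (es i) (ss i) t (\<tau>s i)"
    and eqs: "\<Gamma> = ctx_sum I (\<lambda>i. ctx_pop (\<Gamma>s i))" "m = sum ms I" "e = 1 + sum es I" "s = sum ss I"
    and im: "{#Arrow M \<tau>#} = image_mset (\<lambda>i. Arrow (\<Gamma>s i 0) (\<tau>s i)) (mset_set I)"
    by (rule typing_Lam_MultiE) blast
  have "size (mset_set I) = 1" using arg_cong[OF im, of size] by simp
  then obtain i where "I = {i}" by (auto simp: card_1_singleton_iff)
  with ty eqs im show ?thesis by (intro that[of "\<Gamma>s i"]) (auto simp: ctx_sum_def)
qed

text \<open>The disjunction treats \<open>app_c\<close> and \<open>appt_c\<close> together; at the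
  hole they become \<open>es_c\<close> and \<open>es_p\<close>. The induction generalises
  \<open>u\<close> and its context because both are lifted at each binder of
  \<open>L\<close>.\<close>

lemma typing_ES_lplug_Lam:
  assumes "typing \<Gamma> m e s (lplug L (Lam t)) (Multi {#Arrow M \<tau>#})"
    and "typing \<Delta> m' e' s' u (Multi M) \<or> typing \<Delta> m' e' s' u (Tight N) \<and> tight_mty M"
  shows "typing (ctx_add \<Gamma> \<Delta>) (m + m') (e + e' - 1) (s + s')
    (lplug L (ES t (lift (ldepth L) 0 u))) \<tau>"
  using assms
proof (induction L arbitrary: \<Gamma> m e s \<Delta> u)
  case LHole
  from LHole(1) obtain \<Gamma>' where G: "\<Gamma> = ctx_pop \<Gamma>'" "M = \<Gamma>' 0" "typing \<Gamma>' m (e - 1) s t \<tau>"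
    by (auto elim: typing_Lam_ArrowE)
  with LHole(2) es_p[OF G(3), of \<Delta> m' e' s' u] es_c[OF G(3), of \<Delta> m' e' s' u]
  show ?case by (auto simp: algebra_simps)
next
  case (LES L w)
  have lift: "lift (ldepth L) 0 (lift 1 0 u) = lift (ldepth (LES L w)) 0 u"
    by (simp add: lift_lift)
  \<comment> \<open>The lifted \<open>u\<close> does not use the variable bound here, so the
    derivation of \<open>w\<close> still fits.\<close>
  have zero: "ctx_add \<Gamma>' (ctx_lift 1 0 \<Delta>) 0 = \<Gamma>' 0" for \<Gamma>'
    by (simp add: ctx_defs ctx_lift_def)
  have IH: "typing (ctx_add \<Gamma>' (ctx_lift 1 0 \<Delta>)) (m1 + m') (e1 + e' - 1) (s1 + s')
    (lplug L (ES t (lift (ldepth (LES L w)) 0 u))) \<tau>"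
    if "typing \<Gamma>' m1 e1 s1 (lplug L (Lam t)) (Multi {#Arrow M \<tau>#})" for \<Gamma>' m1 e1 s1
    using LES.IH[OF that, of "ctx_lift 1 0 \<Delta>" "lift 1 0 u"] LES.prems(2) typing_lift
    unfolding lift by blast
  from LES.prems(1)[unfolded lplug.simps] show ?case
  proof (cases rule: typing_ESE)
    case (1 \<Gamma>' m1 e1 s1 \<Delta>' m2 e2 s2)
    show ?thesis unfolding lplug.simps
      by (rule typing_cong[OF es_p[OF IH[OF 1(5)] 1(6), unfolded zero, OF 1(7)]])
        (simp_all add: 1 ctx_defs ctx_lift_def ac_simps)
  next
    case (2 \<Gamma>' m1 e1 s1 \<Delta>' m2 e2 s2)
    show ?thesis unfolding lplug.simps
      by (rule typing_cong[OF es_c[OF IH[OF 2(5)], unfolded zero, OF 2(6)]])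
        (simp_all add: 2 ctx_defs ctx_lift_def ac_simps)
  qed
qed

text \<open>The substitution lemma handles the hole. Each explicit substitution of \<open>L\<close>
  then moves outwards past \<open>t\<close>, which only permutes the sums of contexts and
  counters.\<close>

lemma typing_subst_lplug:
  assumes "is_value v" "typing \<Gamma> m e s t \<sigma>" "typing \<Delta> m' e' s' (lplug L v) (Multi (\<Gamma> 0))"
  shows "typing (ctx_add (ctx_pop \<Gamma>) \<Delta>) (m + m') (e + e' - 1) (s + s')
    (lplug L (subst (lift (ldepth L) 1 t) 0 v)) \<sigma>"
  using assms(2,3)
proof (induction L arbitrary: \<Gamma> t \<Delta> m' e' s')
  case LHole
  have "ctx_del 0 \<Gamma> = ctx_pop \<Gamma>" by (simp add: ctx_del_def ctx_pop_def)
  with typing_subst[OF LHole(1) assms(1), of \<Delta> m' e' s' 0] LHole(2) show ?case by simp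
next
  case (LES L w)
  have lift: "lift (ldepth L) 1 (lift 1 1 t) = lift (ldepth (LES L w)) 1 t"
    by (simp add: lift_lift)
  \<comment> \<open>Lifting from 1 frees index 1 of \<open>t\<close>, which becomes index 0 after
    the pop; so only \<open>lplug L v\<close> determines the multitype at which \<open>w\<close> is
    typed.\<close>
  have zero: "ctx_add (ctx_pop (ctx_lift 1 1 \<Gamma>)) \<Delta>' 0 = \<Delta>' 0" for \<Delta>'
    by (simp add: ctx_defs ctx_lift_def)
  have IH: "typing (ctx_add (ctx_pop (ctx_lift 1 1 \<Gamma>)) \<Delta>') (m + m1) (e + e1 - 1) (s + s1)
    (lplug L (subst (lift (ldepth (LES L w)) 1 t) 0 v)) \<sigma>"
    if "typing \<Delta>' m1 e1 s1 (lplug L v) (Multi (\<Gamma> 0))" for \<Delta>' m1 e1 s1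
    using LES.IH[OF typing_lift[OF LES.prems(1), of 1 1], of \<Delta>' m1 e1 s1] that
    unfolding lift by simp
  from LES.prems(2)[unfolded lplug.simps] show ?case
  proof (cases rule: typing_ESE)
    case (1 \<Delta>' m1 e1 s1 \<Delta>'' m2 e2 s2)
    show ?thesis unfolding lplug.simps
      by (rule typing_cong[OF es_p[OF IH[OF 1(5)] 1(6), unfolded zero, OF 1(7)]])
        (simp_all add: 1 ctx_defs ctx_lift_def ac_simps)
  next
    case (2 \<Delta>' m1 e1 s1 \<Delta>'' m2 e2 s2)
    show ?thesis unfolding lplug.simps
      by (rule typing_cong[OF es_c[OF IH[OF 2(5)], unfolded zero, OF 2(6)]])
        (simp_all add: 2 ctx_defs ctx_lift_def ac_simps)
  qed
qed

lemma typing_dB: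
  assumes "dB r r'" "typing \<Gamma> m e s r \<sigma>"
  shows "typing \<Gamma> (m - 1) e s r' \<sigma>"
  using assms(1)
proof cases
  case (1 L t u)
  from assms(2)[unfolded 1] show ?thesis
  proof (cases rule: typing_AppE)
    case (1 \<Gamma>' m1 e1 s1 c1 \<Delta>' m2 e2 s2 c2)
    from typing_lplugD[OF 1(6)] have "c1 = Vl" using typing_Lam_Tight by blast
    with 1(7) show ?thesis by simp
  next
    case (2 \<Gamma>' m1 e1 s1 M \<Delta>' m2 e2 s2)
    show ?thesis unfolding \<open>r' = _\<close>
      by (rule typing_cong[OF typing_ES_lplug_Lam[OF 2(5) disjI1[OF 2(6)]]]) (simp_all add: 2)
  next
    case (3 \<Gamma>' m1 e1 s1 M \<Delta>' m2 e2 s2)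
    show ?thesis unfolding \<open>r' = _\<close>
      by (rule typing_cong[OF typing_ES_lplug_Lam[OF 3(5) disjI2[OF conjI[OF 3(6,7)]]]])
        (simp_all add: 3)
  qed
qed

lemma typing_sv:
  assumes "sv r r'" "typing \<Gamma> m e s r \<sigma>"
  shows "typing \<Gamma> m (e - 1) s r' \<sigma>"
  using assms(1)
proof cases
  case (1 v t L)
  from assms(2)[unfolded 1] show ?thesis
  proof (cases rule: typing_ESE)
    case (1 \<Gamma>' m1 e1 s1 \<Delta>' m2 e2 s2)
    then show ?thesis using typing_lplug_value_not_N \<open>is_value v\<close> by blast
  next
    case (2 \<Gamma>' m1 e1 s1 \<Delta>' m2 e2 s2)
    show ?thesis unfolding \<open>r' = _\<close>
      by (rule typing_cong[OF typing_subst_lplug[OF \<open>is_value v\<close> 2(5,6)]]) (simp_all add: 2)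
  qed
qed

text \<open>The parameters \<open>a\<close> and \<open>b\<close> serve both kinds of step in one
  induction. The hole lies in exactly one premise of each rule involved, so the decrease is passed
  on unmultiplied.\<close>

lemma typing_vplug:
  assumes "\<And>\<Gamma> m e s \<sigma>. typing \<Gamma> m e s r \<sigma> \<Longrightarrow> typing \<Gamma> (m - a) (e - b) s r' \<sigma>"
    and "typing \<Gamma> m e s (vplug V r) \<sigma>"
  shows "typing \<Gamma> (m - a) (e - b) s (vplug V r') \<sigma>"
  using assms(2)
proof (induction V arbitrary: \<Gamma> m e s \<sigma>)
  case VHole
  then show ?case using assms(1) by simp
next
  case (VAppL V t)
  from VAppL.prems[unfolded vplug.simps] show ?case
  proof (cases rule: typing_AppE)
    case 1
    show ?thesis unfolding vplug.simps
      by (rule typing_cong[OF app_p[OF VAppL.IH[OF 1(6)] _ 1(8)]]) (use 1 in auto)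
  next
    case 2
    show ?thesis unfolding vplug.simps
      by (rule typing_cong[OF app_c[OF VAppL.IH[OF 2(5)] 2(6)]]) (simp_all add: 2)
  next
    case 3
    show ?thesis unfolding vplug.simps
      by (rule typing_cong[OF appt_c[OF VAppL.IH[OF 3(5)] 3(6,7)]]) (simp_all add: 3)
  qed
next
  case (VAppR t V)
  from VAppR.prems[unfolded vplug.simps] show ?case
  proof (cases rule: typing_AppE)
    case 1
    show ?thesis unfolding vplug.simps
      by (rule typing_cong[OF app_p[OF 1(6) _ VAppR.IH[OF 1(8)]]]) (use 1 in auto)
  next
    case 2
    show ?thesis unfolding vplug.simps
      by (rule typing_cong[OF app_c[OF 2(5) VAppR.IH[OF 2(6)]]]) (simp_all add: 2)
  next
    case 3
    show ?thesis unfolding vplug.simps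
      by (rule typing_cong[OF appt_c[OF 3(5) VAppR.IH[OF 3(6)] 3(7)]]) (simp_all add: 3)
  qed
next
  case (VESL V u)
  from VESL.prems[unfolded vplug.simps] show ?case
  proof (cases rule: typing_ESE)
    case 1
    show ?thesis unfolding vplug.simps
      by (rule typing_cong[OF es_p[OF VESL.IH[OF 1(5)] 1(6,7)]]) (simp_all add: 1)
  next
    case 2
    show ?thesis unfolding vplug.simps
      by (rule typing_cong[OF es_c[OF VESL.IH[OF 2(5)] 2(6)]]) (simp_all add: 2)
  qed
next
  case (VESR t V)
  from VESR.prems[unfolded vplug.simps] show ?case
  proof (cases rule: typing_ESE)
    case 1
    show ?thesis unfolding vplug.simps
      by (rule typing_cong[OF es_p[OF 1(5) VESR.IH[OF 1(6)] 1(7)]]) (simp_all add: 1)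
  next
    case 2
    show ?thesis unfolding vplug.simps
      by (rule typing_cong[OF es_c[OF 2(5) VESR.IH[OF 2(6)]]]) (simp_all add: 2)
  qed
qed

lemma subject_reduction_m:
  assumes "step_m t t'" "typing \<Gamma> m e s t \<sigma>"
  shows "typing \<Gamma> (m - 1) e s t' \<sigma>"
  using assms typing_vplug[where a = 1 and b = 0] typing_dB by (fastforce elim: step_m.cases)

lemma subject_reduction_e:
  assumes "step_e t t'" "typing \<Gamma> m e s t \<sigma>"
  shows "typing \<Gamma> m (e - 1) s t' \<sigma>"
  using assms typing_vplug[where a = 0 and b = 1] typing_sv by (fastforce elim: step_e.cases)

section \<open>Irreducible terms\<close>

definition irreducible :: "trm \<Rightarrow> bool" where
  "irreducible t \<longleftrightarrow> (\<nexists>u. step_m t u \<or> step_e t u)"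

lemma irreducible_vplug: "irreducible (vplug V t) \<Longrightarrow> irreducible t"
proof -
  \<comment> \<open>\<open>W\<close> is the composition of the two contexts: a step inside the
    plugged subterm is a step of the whole term.\<close>
  have "\<exists>W. \<forall>r. vplug V (vplug U r) = vplug W r" for U
  proof (induction V)
    case VHole show ?case by auto
  next
    case (VAppL V t) then show ?case by (metis vplug.simps(2))
  next
    case (VAppR t V) then show ?case by (metis vplug.simps(3))
  next
    case (VESL V t) then show ?case by (metis vplug.simps(4))
  next
    case (VESR t V) then show ?case by (metis vplug.simps(5))
  qed
  then show "irreducible (vplug V t) \<Longrightarrow> irreducible t"
    unfolding irreducible_def by (metis step_m.simps step_e.simps)
qed

lemma irreducible_App: "irreducible (App t u) \<Longrightarrow> irreducible t \<and> irreducible u"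
  using irreducible_vplug[of "VAppL VHole u" t] irreducible_vplug[of "VAppR t VHole" u] by simp

lemma irreducible_ES: "irreducible (ES t u) \<Longrightarrow> irreducible t \<and> irreducible u"
  using irreducible_vplug[of "VESL VHole u" t] irreducible_vplug[of "VESR t VHole" u] by simp

lemma not_irreducible_dB: "\<not> irreducible (App (lplug L (Lam t)) u)"
  unfolding irreducible_def by (metis dB.intros step_m.intros vplug.simps(1))

lemma not_irreducible_sv: "is_value v \<Longrightarrow> \<not> irreducible (ES t (lplug L v))"
  unfolding irreducible_def by (metis sv.intros step_e.intros vplug.simps(1))

text \<open>Shows that an explicit substitution whose argument is in \<open>vr_v\<close> is an
  \<open>sv\<close> redex.\<close>

lemma vr_v_lplug_Var: "vr_v t \<Longrightarrow> \<exists>L x. t = lplug L (Var x)"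
proof (induction t)
  case (ES t u)
  then have "vr_v t" by (auto elim: vr_v.cases)
  with ES.IH show ?case by (metis lplug.simps(2))
qed (auto elim: vr_v.cases intro: exI[of _ LHole])

section \<open>The shape of typed irreducible terms\<close>

lemma tight_ctx_add: "tight_ctx (ctx_add \<Gamma> \<Delta>) \<longleftrightarrow> tight_ctx \<Gamma> \<and> tight_ctx \<Delta>"
  by (auto simp: tight_ctx_def tight_mty_def ctx_add_def)

lemma tight_ctx_pop: "tight_ctx (ctx_pop \<Gamma>) \<Longrightarrow> tight_mty (\<Gamma> 0) \<Longrightarrow> tight_ctx \<Gamma>"
  unfolding tight_ctx_def ctx_pop_def by (metis not0_implies_Suc)

text \<open>Induction hypothesis for irreducible terms in a tight context. It must cover multitypes,
  which occur in the premises of the rules to be excluded: there the term is a value under a list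
  context, and a variable has only the tight types that the context offers.\<close>

fun nf_spec :: "int \<Rightarrow> int \<Rightarrow> int \<Rightarrow> trm \<Rightarrow> ty \<Rightarrow> bool" where
  "nf_spec m e s t (Tight c) \<longleftrightarrow> m = 0 \<and> e = 0 \<and> s = int (vsize t) \<and>
     (case c of N \<Rightarrow> ne_v t | Vl \<Rightarrow> no_v t | Vr \<Rightarrow> vr_v t)"
| "nf_spec m e s t (Multi M) \<longleftrightarrow> (\<exists>L r. t = lplug L (Lam r)) \<or> vr_v t \<and> tight_mty M"
| "nf_spec m e s t (Arrow M \<tau>) \<longleftrightarrow> True"

text \<open>Each class of normal forms, and abstractions under list contexts, are closed under
  explicit substitution of a \<open>ne_v\<close> term, which adds its size and no steps.\<close>

lemma nf_spec_ES:
  assumes "nf_spec m e s t \<tau>" "nf_spec m' e' s' u (Tight N)"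
  shows "nf_spec (m + m') (e + e') (s + s') (ES t u) \<tau>"
proof (cases \<tau>)
  case (Tight c)
  with assms show ?thesis by (cases c) (auto intro: vr_v_ne_v_no_v.intros)
next
  case (Multi M)
  from assms Multi consider L r where "t = lplug L (Lam r)" | "vr_v t" "tight_mty M" by auto
  then show ?thesis
  proof cases
    case 1
    then have "ES t u = lplug (LES L u) (Lam r)" by simp
    then show ?thesis using Multi by (metis nf_spec.simps(2))
  next
    case 2
    then show ?thesis using assms(2) Multi by (auto intro: vr_v_ne_v_no_v.intros(2))
  qed
qed auto

lemma typing_irreducible:
  "typing \<Gamma> m e s t \<sigma> \<Longrightarrow> tight_ctx \<Gamma> \<Longrightarrow> irreducible t \<Longrightarrow> nf_spec m e s t \<sigma>"
proof (induction rule: typing.induct)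
  case (app_p \<Gamma> m e s t c1 \<Delta> m' e' s' u c2)
  have "nf_spec m e s t (Tight c1)" "nf_spec m' e' s' u (Tight c2)"
    using app_p.IH app_p.prems irreducible_App[of t u] by (simp_all add: tight_ctx_add)
  moreover from this app_p.hyps(4) have "no_v u" by (auto intro: vr_v_ne_v_no_v.intros(8))
  ultimately show ?case using app_p.hyps(2) app_p.hyps(4)
    by (auto intro: vr_v_ne_v_no_v.intros(3,4))
next
  case (es_p \<Gamma> m e s t \<tau> \<Delta> m' e' s' u)
  have "nf_spec m e s t \<tau>" "nf_spec m' e' s' u (Tight N)"
    using es_p.IH es_p.prems es_p.hyps(3) irreducible_ES[of t u] tight_ctx_pop[of \<Gamma>]
    by (simp_all add: tight_ctx_add)
  then show ?case by (rule nf_spec_ES)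
next
  case (var_c x M)
  then have "tight_mty (ctx_single x M x)" unfolding tight_ctx_def by blast
  then show ?case by (simp add: ctx_single_def vr_v_ne_v_no_v.intros(1))
next
  case (app_c \<Gamma> m e s t M \<tau> \<Delta> m' e' s' u)
  have "nf_spec m e s t (Multi {#Arrow M \<tau>#})"
    using app_c.IH(1) app_c.prems irreducible_App[of t u] by (simp add: tight_ctx_add)
  \<comment> \<open>An arrow is not tight, so \<open>t\<close> is an abstraction under a list
    context and its application is a redex.\<close>
  with app_c.prems show ?case
    using not_irreducible_dB by (auto simp: tight_mty_def tight_ty_def)
next
  case (appt_c \<Gamma> m e s t M \<tau> \<Delta> m' e' s' u)
  have "nf_spec m e s t (Multi {#Arrow M \<tau>#})"
    using appt_c.IH(1) appt_c.prems irreducible_App[of t u] by (simp add: tight_ctx_add)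
  with appt_c.prems show ?case
    using not_irreducible_dB by (auto simp: tight_mty_def tight_ty_def)
next
  case (abs_c I \<Gamma> m e s t \<tau>)
  show ?case by (auto intro: exI[of _ LHole])
next
  case (es_c \<Gamma> m e s t \<sigma> \<Delta> m' e' s' u)
  \<comment> \<open>The multitype of the bound variable may fail to be tight, so only the hypothesis
    for \<open>u\<close> is available; it already exhibits a redex.\<close>
  have "nf_spec m' e' s' u (Multi (\<Gamma> 0))"
    using es_c.IH(2) es_c.prems irreducible_ES[of t u] by (simp add: tight_ctx_add)
  then obtain L v where "u = lplug L v" "is_value v"
    using vr_v_lplug_Var is_value.intros by (metis nf_spec.simps(2))
  with es_c.prems show ?case using not_irreducible_sv by blast
qed (auto intro: vr_v_ne_v_no_v.intros)

lemma tight_typing_irreducible: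
  assumes "typing \<Gamma> m e s t \<sigma>" "tight_ctx \<Gamma>" "tight_ty \<sigma>" "irreducible t"
  shows "no_v t \<and> m = 0 \<and> e = 0 \<and> int (vsize t) = s"
proof -
  from assms(3) obtain c where "\<sigma> = Tight c" by (auto simp: tight_ty_def)
  with typing_irreducible[OF assms(1,2,4)] show ?thesis
    by (cases c) (auto intro: vr_v_ne_v_no_v.intros)
qed

section \<open>Tight typings and reduction to normal form\<close>

theorem theorem4p8:
  fixes \<Gamma> :: ctx and m e s :: int and t :: trm and \<sigma> :: ty
  assumes "typing \<Gamma> m e s t \<sigma>"
    and "tight_ctx \<Gamma>" and "tight_ty \<sigma>"
  shows "\<exists>p k l. no_v p \<and> m = int k \<and> e = int l \<and> reduces k l t p \<and> int (vsize p) = s"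
  using assms(1)
\<comment> \<open>Any available step may be taken. That \<open>e\<close> is a natural number emerges
  from the induction: both counters are 0 at an irreducible term, and each step adds 1 to one of
  them.\<close>
proof (induction "nat (m + e)" arbitrary: m e t rule: less_induct)
  case less
  consider "irreducible t" | u where "step_m t u" | u where "step_e t u"
    unfolding irreducible_def by blast
  then show ?case
  proof cases
    case 1
    then show ?thesis
      using tight_typing_irreducible[OF less.prems assms(2,3)] reduces.refl
      by (intro exI[of _ t] exI[of _ 0]) auto
  next
    case 2
    note ty = subject_reduction_m[OF 2 less.prems]
    \<comment> \<open>\<open>nat\<close> truncates at 0; strictness holds because the sum is
      nonnegative even after the step, hence at least 1 before it.\<close>
    have "nat (m - 1 + e) < nat (m + e)" using typing_counters_nonneg[OF ty] by simp
    from less.hyps[OF this ty] obtain p k l where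
      "no_v p" "m - 1 = int k" "e = int l" "reduces k l u p" "int (vsize p) = s" by blast
    with 2 show ?thesis by (intro exI[of _ p] exI[of _ "Suc k"] exI[of _ l]) (auto intro: reduces.mult)
  next
    case 3
    note ty = subject_reduction_e[OF 3 less.prems]
    have "nat (m + (e - 1)) < nat (m + e)" using typing_counters_nonneg[OF ty] by simp
    from less.hyps[OF this ty] obtain p k l where
      "no_v p" "m = int k" "e - 1 = int l" "reduces k l u p" "int (vsize p) = s" by blast
    with 3 show ?thesis by (intro exI[of _ p] exI[of _ k] exI[of _ "Suc l"]) (auto intro: reduces.expo)
  qed
qed

end
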